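(* Let $(K^*,r^* )$ be a gap between $A$ and $B$. Suppose $F(x,y)=i_B(x)+D(x,y)+i_A(y)$ satisfies the Kurdyka-\L ojasiewicz condition at every $(b^*,a^* )\in K^*$. Then there exist a neighborhood $W$ of $K^*$, a de-singularizing function $\phi$, and constants $\gamma,\eta>0$ such that every $rl$-building block $b\to a^+\to b^+$ with $(b^+,a^+)\in W$ and $\frac12r^{*2}<D(b^+,a^+)<\frac12r^{*2}+\eta$ satisfies $$\phi'\big(\overleftarrow{D}_B(a^+)-\tfrac12r^{*2}\big)^2\,\overleftarrow{D}_B(a^+)\,(1-\cos\alpha)\ge\gamma,$$ where $\alpha$ is the angle between $b-a^+$ and $b^+-a^+$.
   Context: Setting: $f:\mathbb R^d\to\mathbb R\cup\{+\infty\}$ is a convex function of Legendre type (in Rockafellar's sense), $G:=\mathrm{int}(\mathrm{dom} f)$, $f$ is of class $C^2$ on $G$ and $\nabla^2f(x)\succ0$ for all $x\in G$. The Bregman distance is $D(x,y)=f(x)-f(y)-\langle\nabla f(y),x-y\rangle$ for $y\in G$ and $D(x,y)=+\infty$ otherwise. $A,B\subset G$ are nonempty, closed and bounded; $i_A,i_B$ are the indicator functions ($0$ on the set, $+\infty$ off it). Projections: $\overleftarrow{D}_B(a)=\min\{D(b',a):b'\in B\}$, $\overleftarrow{P}_B(a)=\mathrm{argmin}\{D(b',a):b'\in B\}$; $\overrightarrow{P}_A(b)=\mathrm{argmin}\{D(b,a'):a'\in A\}$ (set-valued). An $rl$-building block $b\to a^+\to b^+$ consists of $b\in B$, $a^+\in\overrightarrow{P}_A(b)$,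 $b^+\in\overleftarrow{P}_B(a^+)$. For $b^*\in B$, $a^*\in A$ write $b^*\sim a^*$ if $a^*\in\overrightarrow{P}_A(b^* )$ and $b^*\in\overleftarrow{P}_B(a^* )$. A gap between $A$ and $B$ is a pair $(K^*,r^* )$ with $r^*\ge0$ and $K^*\subset B\times A$ compact such that $b^*\sim a^*$ and $D(b^*,a^* )=\frac12r^{*2}$ for all $(b^*,a^* )\in K^*$. De-singularizing function: a continuous concave $\phi:[0,\eta)\to\mathbb R_+$ with $\phi(0)=0$, $\phi$ of class $C^1$ on $(0,\eta)$, $\phi'>0$ on $(0,\eta)$. A lower semi-continuous $F:\mathbb R^n\to\mathbb R\cup\{+\infty\}$ satisfies the Kurdyka-\L ojasiewicz condition at $\bar x\in\mathrm{dom}(\partial F)$ if there exist $\eta>0$, a neighborhood $U$ of $\bar x$ and a de-singularizing function $\phi:[0,\eta)\to\mathbb R_+$ such that $\phi'(F(x)-F(\bar x))\,\mathrm{dist}(0,\partial F(x))\ge1$ for all $x\in U$ with $F(\bar x)<F(x)<F(\bar x)+\eta$, where $\partial F$ is the limiting (Mordukhovich) subdifferential. *)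

theory Defs
  imports "HOL-Analysis.Analysis"
begin

section \<open>Legendre functions\<close>

definition eff_domain :: "('a \<Rightarrow> ereal) \<Rightarrow> 'a set"
  where "eff_domain f = {x. f x < \<infinity>}"

abbreviation int_dom :: "('a::topological_space \<Rightarrow> ereal) \<Rightarrow> 'a set"
  where "int_dom f \<equiv> interior (eff_domain f)"

text \<open>Convexity of an extended-real-valued function, via its epigraph
  (the library's \<open>convex_on\<close> is for real-valued functions).\<close>

definition ereal_convex :: "('a::real_vector \<Rightarrow> ereal) \<Rightarrow> bool"
  where "ereal_convex f \<longleftrightarrow> convex {(x, t::real). f x \<le> ereal t}"

text \<open>Gradient and Hessian of the finite part of \<open>f\<close>; meaningful at points of \<open>int_dom f\<close>
  where the respective derivative exists.\<close>

definition grad :: "('a::real_inner \<Rightarrow> ereal) \<Rightarrow> 'a \<Rightarrow> 'a"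
  where "grad f x = (THE g. GDERIV (\<lambda>z. real_of_ereal (f z)) x :> g)"

definition hessian :: "(real ^ 'd \<Rightarrow> ereal) \<Rightarrow> real ^ 'd \<Rightarrow> real ^ 'd ^ 'd"
  where "hessian f x = jacobian (grad f) (at x)"

text \<open>Rockafellar, Convex Analysis, Section 26: \<open>f\<close> is proper convex, and on the nonempty open
  set \<open>int (dom f)\<close> it is differentiable and strictly convex, with gradients blowing up along
  every sequence that approaches a boundary point.\<close>

definition legendre_type :: "('a::real_inner \<Rightarrow> ereal) \<Rightarrow> bool"
  where "legendre_type f \<longleftrightarrow>
    (\<forall>x. f x \<noteq> -\<infinity>) \<and> ereal_convex f \<and> int_dom f \<noteq> {} \<and>
    (\<forall>x\<in>int_dom f. (\<lambda>z. real_of_ereal (f z)) differentiable at x) \<and>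
    (\<forall>x\<in>int_dom f. \<forall>y\<in>int_dom f. \<forall>t. x \<noteq> y \<longrightarrow> 0 < t \<longrightarrow> t < 1 \<longrightarrow>
       f ((1 - t) *\<^sub>R x + t *\<^sub>R y) < ereal (1 - t) * f x + ereal t * f y) \<and>
    (\<forall>u. \<forall>x\<in>frontier (int_dom f). (\<forall>k. u k \<in> int_dom f) \<longrightarrow> u \<longlonglongrightarrow> x \<longrightarrow>
       filterlim (\<lambda>k. norm (grad f (u k))) at_top sequentially)"

definition C2_int_dom :: "(real ^ 'd \<Rightarrow> ereal) \<Rightarrow> bool"
  where "C2_int_dom f \<longleftrightarrow>
    (\<forall>x\<in>int_dom f. (\<lambda>z. real_of_ereal (f z)) differentiable at x \<and> grad f differentiable at x) \<and>
    continuous_on (int_dom f) (hessian f)"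

text \<open>Symmetry is not required here because it is automatic for Hessians of \<open>C\<^sup>2\<close> functions.\<close>

definition pos_def :: "real ^ 'd ^ 'd \<Rightarrow> bool"
  where "pos_def M \<longleftrightarrow> (\<forall>h. h \<noteq> 0 \<longrightarrow> h \<bullet> (M *v h) > 0)"


section \<open>Bregman distance and projections\<close>

definition bregman :: "('a::real_inner \<Rightarrow> ereal) \<Rightarrow> 'a \<Rightarrow> 'a \<Rightarrow> ereal"
  where "bregman f x y =
    (if y \<in> int_dom f then f x - f y - ereal (grad f y \<bullet> (x - y)) else \<infinity>)"

text \<open>The infimum in \<open>left_dist\<close> is a minimum when \<open>B\<close> is a nonempty compact subset
  of \<open>int_dom f\<close> and \<open>f\<close> is differentiable there.\<close>

definition left_dist :: "('a::real_inner \<Rightarrow> ereal) \<Rightarrow> 'a set \<Rightarrow> 'a \<Rightarrow> ereal"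
  where "left_dist f B a = (INF b\<in>B. bregman f b a)"

definition left_proj :: "('a::real_inner \<Rightarrow> ereal) \<Rightarrow> 'a set \<Rightarrow> 'a \<Rightarrow> 'a set"
  where "left_proj f B a = {b. is_arg_min (\<lambda>b'. bregman f b' a) (\<lambda>b'. b' \<in> B) b}"

definition right_proj :: "('a::real_inner \<Rightarrow> ereal) \<Rightarrow> 'a set \<Rightarrow> 'a \<Rightarrow> 'a set"
  where "right_proj f A b = {a. is_arg_min (\<lambda>a'. bregman f b a') (\<lambda>a'. a' \<in> A) a}"

definition rl_building_block ::
    "('a::real_inner \<Rightarrow> ereal) \<Rightarrow> 'a set \<Rightarrow> 'a set \<Rightarrow> 'a \<Rightarrow> 'a \<Rightarrow> 'a \<Rightarrow> bool"
  where "rl_building_block f A B b a' b' \<longleftrightarrow>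
    b \<in> B \<and> a' \<in> right_proj f A b \<and> b' \<in> left_proj f B a'"

definition is_gap ::
    "('a::real_inner \<Rightarrow> ereal) \<Rightarrow> 'a set \<Rightarrow> 'a set \<Rightarrow> ('a \<times> 'a) set \<Rightarrow> real \<Rightarrow> bool"
  where "is_gap f A B K r \<longleftrightarrow>
    r \<ge> 0 \<and> compact K \<and> K \<subseteq> B \<times> A \<and>
    (\<forall>(b, a)\<in>K. a \<in> right_proj f A b \<and> b \<in> left_proj f B a \<and> bregman f b a = ereal (r\<^sup>2 / 2))"

definition ind_fun :: "'a set \<Rightarrow> 'a \<Rightarrow> ereal"
  where "ind_fun S x = (if x \<in> S then 0 else \<infinity>)"

definition vec_angle :: "'a::real_inner \<Rightarrow> 'a \<Rightarrow> real"
  where "vec_angle u v = arccos (u \<bullet> v / (norm u * norm v))"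


section \<open>Subdifferentials and the Kurdyka-Lojasiewicz condition\<close>

definition frechet_subdiff :: "('a::euclidean_space \<Rightarrow> ereal) \<Rightarrow> 'a \<Rightarrow> 'a set"
  where "frechet_subdiff F x = {v. \<bar>F x\<bar> \<noteq> \<infinity> \<and>
    Liminf (at x) (\<lambda>y. (F y - F x - ereal (v \<bullet> (y - x))) / ereal (norm (y - x))) \<ge> 0}"

definition limiting_subdiff :: "('a::euclidean_space \<Rightarrow> ereal) \<Rightarrow> 'a \<Rightarrow> 'a set"
  where "limiting_subdiff F x = {v. \<bar>F x\<bar> \<noteq> \<infinity> \<and>
    (\<exists>u w. u \<longlonglongrightarrow> x \<and> (\<lambda>k. F (u k)) \<longlonglongrightarrow> F x \<and>
       (\<forall>k. w k \<in> frechet_subdiff F (u k)) \<and> w \<longlonglongrightarrow> v)}"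

definition desingularizing :: "real \<Rightarrow> (real \<Rightarrow> real) \<Rightarrow> bool"
  where "desingularizing \<eta> \<phi> \<longleftrightarrow>
    continuous_on {0..<\<eta>} \<phi> \<and> concave_on {0..<\<eta>} \<phi> \<and> \<phi> 0 = 0 \<and> (\<forall>t\<in>{0..<\<eta>}. \<phi> t \<ge> 0) \<and>
    (\<forall>t\<in>{0<..<\<eta>}. \<phi> differentiable at t) \<and> continuous_on {0<..<\<eta>} (deriv \<phi>) \<and>
    (\<forall>t\<in>{0<..<\<eta>}. deriv \<phi> t > 0)"

text \<open>The distance from \<open>0\<close> to the subdifferential is an infimum in the extended reals, so it is
  \<open>\<infinity>\<close> when the subdifferential is empty (the library's \<open>infdist\<close> would give \<open>0\<close>).\<close>

definition KL_at :: "('a::euclidean_space \<Rightarrow> ereal) \<Rightarrow> 'a \<Rightarrow> bool"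
  where "KL_at F xbar \<longleftrightarrow> limiting_subdiff F xbar \<noteq> {} \<and>
    (\<exists>\<eta> U \<phi>. \<eta> > 0 \<and> open U \<and> xbar \<in> U \<and> desingularizing \<eta> \<phi> \<and>
      (\<forall>x\<in>U. F xbar < F x \<longrightarrow> F x < F xbar + ereal \<eta> \<longrightarrow>
        ereal (deriv \<phi> (real_of_ereal (F x - F xbar))) *
          (INF v\<in>limiting_subdiff F x. ereal (dist 0 v)) \<ge> 1))"

end

theory Submission
  imports Defs
begin

text \<open>
  Let \<open>b \<rightarrow> a\<^sup>+ \<rightarrow> b\<^sup>+\<close> be a building block, \<open>u = b - a\<^sup>+\<close>, \<open>v = b\<^sup>+ - a\<^sup>+\<close>.
  Optimality of \<open>a\<^sup>+\<close> for \<open>D(b, \<cdot>)\<close> makes every nonnegative multiple of the vector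
  \<open>\<nabla>\<^sup>2f(a\<^sup>+) u\<close> normal to \<open>A\<close> at \<open>a\<^sup>+\<close>, and optimality of \<open>b\<^sup>+\<close> for \<open>D(\<cdot>, a\<^sup>+)\<close>
  cancels the \<open>x\<close>-part of the gradient of \<open>D\<close>. Hence \<open>(0, \<nabla>\<^sup>2f(a\<^sup>+)(s u - v))\<close> is a
  subgradient of \<open>F\<close> at \<open>(b\<^sup>+, a\<^sup>+)\<close> for every \<open>s \<ge> 0\<close>. The choice \<open>s = |v|/|u|\<close> gives
  \<open>|s u - v|\<^sup>2 = 2 |v|\<^sup>2 (1 - cos \<alpha>)\<close>, while \<open>|v|\<^sup>2\<close> is at most a constant times \<open>D(b\<^sup>+, a\<^sup>+)\<close>
  by strong convexity of \<open>f\<close> on the convex hull of \<open>A \<union> B\<close>; the Kurdyka-Lojasiewicz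
  inequality then yields the claim. A single \<open>\<phi>\<close> serves all of \<open>K\<^sup>*\<close>: sum the
  desingularizing functions of a finite subcover.
\<close>

subsection \<open>Subgradients\<close>

lemma frechet_subdiff_subset_limiting_subdiff: "frechet_subdiff F x \<subseteq> limiting_subdiff F x"
proof
  fix v assume v: "v \<in> frechet_subdiff F x"
  then have "\<bar>F x\<bar> \<noteq> \<infinity>" by (simp add: frechet_subdiff_def)
  moreover have "\<exists>u w. u \<longlonglongrightarrow> x \<and> (\<lambda>k. F (u k)) \<longlonglongrightarrow> F x \<and>
       (\<forall>k. w k \<in> frechet_subdiff F (u k)) \<and> w \<longlonglongrightarrow> v"
    by (rule exI[of _ "\<lambda>k. x"], rule exI[of _ "\<lambda>k. v"]) (simp add: v)
  ultimately show "v \<in> limiting_subdiff F x" unfolding limiting_subdiff_def by blast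
qed

text \<open>The error \<open>\<theta> y - \<theta> x\<close> is o(|y - x|), so a minorant that
  touches \<open>F\<close> at \<open>x\<close> with slope \<open>v\<close> bounds the difference
  quotients below by a null function. Minimality conditions thus yield subgradients without a
  calculus of normal cones.\<close>

lemma mem_frechet_subdiffI:
  fixes F :: "'a::euclidean_space \<Rightarrow> ereal" and \<theta> :: "'a \<Rightarrow> real"
  assumes Fx: "F x = ereal c" and D: "(\<theta> has_derivative (\<lambda>h. 0)) (at x)"
    and ge: "\<forall>\<^sub>F y in at x. ereal (c + v \<bullet> (y - x) + (\<theta> y - \<theta> x)) \<le> F y"
  shows "v \<in> frechet_subdiff F x"
proof -
  let ?q = "\<lambda>y. (1 / norm (y - x)) *\<^sub>R (\<theta> y - (\<theta> x + 0))"
  have "((\<lambda>y. ereal (?q y)) \<longlongrightarrow> ereal 0) (at x)"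
    using D by (intro tendsto_intros) (simp add: has_derivative_within)
  then have "Liminf (at x) (\<lambda>y. ereal (?q y)) = ereal 0"
    by (intro lim_imp_Liminf) auto
  moreover have "Liminf (at x) (\<lambda>y. ereal (?q y)) \<le>
      Liminf (at x) (\<lambda>y. (F y - F x - ereal (v \<bullet> (y - x))) / ereal (norm (y - x)))"
  proof (rule Liminf_mono)
    have "\<forall>\<^sub>F y in at x. y \<noteq> x" by (simp add: eventually_at_filter)
    with ge show "\<forall>\<^sub>F y in at x. ereal (?q y) \<le>
        (F y - F x - ereal (v \<bullet> (y - x))) / ereal (norm (y - x))"
    proof eventually_elim
      case (elim y)
      then have "norm (y - x) > 0" by simp
      show ?case
      proof (cases "F y")
        case (real s)
        then have "(\<theta> y - \<theta> x) / norm (y - x) \<le> (s - c - v \<bullet> (y - x)) / norm (y - x)"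
          using elim(1) by (intro divide_right_mono) auto
        then show ?thesis using real Fx \<open>norm (y - x) > 0\<close> by simp
      qed (use elim Fx in auto)
    qed
  qed
  ultimately show ?thesis using Fx by (simp add: frechet_subdiff_def zero_ereal_def)
qed

text \<open>The infimum lies below each of its members and \<open>deriv \<phi>\<close> is positive,
  so the condition can be tested on a single subgradient, in real numbers.\<close>

lemma KL_atE:
  assumes "KL_at F p"
  obtains \<eta> U \<phi> where "\<eta> > 0" "open U" "p \<in> U" "desingularizing \<eta> \<phi>"
    "\<And>x v c d. \<lbrakk>x \<in> U; F p = ereal c; F x = ereal d; c < d; d < c + \<eta>; v \<in> limiting_subdiff F x\<rbrakk>
       \<Longrightarrow> deriv \<phi> (d - c) * norm v \<ge> 1"
proof -
  obtain \<eta> U \<phi> where *: "\<eta> > 0" "open U" "p \<in> U" "desingularizing \<eta> \<phi>"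
    and kl: "\<forall>x\<in>U. F p < F x \<longrightarrow> F x < F p + ereal \<eta> \<longrightarrow>
        ereal (deriv \<phi> (real_of_ereal (F x - F p))) *
          (INF v\<in>limiting_subdiff F x. ereal (dist 0 v)) \<ge> 1"
    using assms unfolding KL_at_def by blast
  have "deriv \<phi> (d - c) * norm v \<ge> 1"
    if "x \<in> U" "F p = ereal c" "F x = ereal d" "c < d" "d < c + \<eta>" "v \<in> limiting_subdiff F x"
    for x v c d
  proof -
    have pos: "deriv \<phi> (d - c) > 0" using *(4) that unfolding desingularizing_def by auto
    have "1 \<le> ereal (deriv \<phi> (d - c)) * (INF v\<in>limiting_subdiff F x. ereal (dist 0 v))"
      using kl that by auto
    also have "\<dots> \<le> ereal (deriv \<phi> (d - c)) * ereal (dist 0 v)"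
      using pos that(6) by (intro ereal_mult_left_mono INF_lower) auto
    finally show ?thesis by (simp add: one_ereal_def)
  qed
  with * show ?thesis by (intro that) auto
qed

subsection \<open>Desingularizing functions\<close>

lemma desingularizing_mono:
  assumes "desingularizing \<eta> \<phi>" "\<eta>' \<le> \<eta>"
  shows "desingularizing \<eta>' \<phi>"
proof -
  have *: "{0..<\<eta>'} \<subseteq> {0..<\<eta>}" "{0<..<\<eta>'} \<subseteq> {0<..<\<eta>}" using assms(2) by auto
  have "convex_on {0..<\<eta>} (\<lambda>t. - \<phi> t)"
    using assms(1) by (simp add: desingularizing_def concave_on_def)
  then have "convex_on {0..<\<eta>'} (\<lambda>t. - \<phi> t)"
    using *(1) by (rule convex_on_subset) simp
  moreover have "continuous_on {0..<\<eta>'} \<phi>" "continuous_on {0<..<\<eta>'} (deriv \<phi>)"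
    using assms(1) * continuous_on_subset by (auto simp only: desingularizing_def)
  ultimately show ?thesis
    using assms(1) * by (simp add: desingularizing_def concave_on_def subset_iff)
qed

lemma deriv_add_desingularizing:
  assumes "desingularizing \<eta> \<phi>" "desingularizing \<eta> \<psi>" "t \<in> {0<..<\<eta>}"
  shows "deriv (\<lambda>t. \<phi> t + \<psi> t) t = deriv \<phi> t + deriv \<psi> t"
  by (rule deriv_add)
    (use assms in \<open>simp_all add: desingularizing_def field_differentiable_def real_differentiable_def\<close>)

lemma desingularizing_add:
  assumes "desingularizing \<eta> \<phi>" "desingularizing \<eta> \<psi>"
  shows "desingularizing \<eta> (\<lambda>t. \<phi> t + \<psi> t)"
proof -
  note deriv = deriv_add_desingularizing[OF assms]
  have "continuous_on {0<..<\<eta>} (\<lambda>t. deriv \<phi> t + deriv \<psi> t)"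
    using assms by (intro continuous_on_add) (simp_all add: desingularizing_def)
  then have "continuous_on {0<..<\<eta>} (deriv (\<lambda>t. \<phi> t + \<psi> t))"
    using deriv by (subst continuous_on_cong[OF refl]) auto
  moreover have "concave_on {0..<\<eta>} (\<lambda>t. \<phi> t + \<psi> t)"
    using assms by (intro concave_on_add) (simp_all add: desingularizing_def)
  moreover have "continuous_on {0..<\<eta>} (\<lambda>t. \<phi> t + \<psi> t)"
    using assms by (intro continuous_on_add) (simp_all add: desingularizing_def)
  ultimately show ?thesis
    using assms deriv by (simp add: desingularizing_def add_pos_pos)
qed

lemma desingularizing_id: "desingularizing \<eta> (\<lambda>t. t)"
  by (simp add: desingularizing_def concave_on_ident)

text \<open>All derivatives are positive, so the derivative of a sum dominates that of each summand;
  this replaces the functions of a finite cover by one.\<close>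

lemma finite_desingularizing_bound:
  assumes "finite I" "\<And>i. i \<in> I \<Longrightarrow> \<eta> i > 0 \<and> desingularizing (\<eta> i) (\<phi> i)"
  obtains \<delta> \<psi> where "\<delta> > 0" "desingularizing \<delta> \<psi>" "\<And>i. i \<in> I \<Longrightarrow> \<delta> \<le> \<eta> i"
    "\<And>i t. i \<in> I \<Longrightarrow> t \<in> {0<..<\<delta>} \<Longrightarrow> deriv (\<phi> i) t \<le> deriv \<psi> t"
proof -
  have "\<exists>\<delta> \<psi>. \<delta> > 0 \<and> desingularizing \<delta> \<psi> \<and>
      (\<forall>i\<in>I. \<delta> \<le> \<eta> i \<and> (\<forall>t\<in>{0<..<\<delta>}. deriv (\<phi> i) t \<le> deriv \<psi> t))"
    using assms
  proof (induction rule: finite_induct)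
    case empty
    \<comment> \<open>The identity starts the induction, since the zero function lacks a positive
      derivative.\<close>
    have "(1::real) > 0" by simp
    then show ?case using desingularizing_id by blast
  next
    case (insert j I)
    then obtain \<delta> \<psi> where IH: "\<delta> > 0" "desingularizing \<delta> \<psi>"
      "\<forall>i\<in>I. \<delta> \<le> \<eta> i \<and> (\<forall>t\<in>{0<..<\<delta>}. deriv (\<phi> i) t \<le> deriv \<psi> t)" by auto
    let ?\<epsilon> = "min \<delta> (\<eta> j)"
    have d: "desingularizing ?\<epsilon> \<psi>" "desingularizing ?\<epsilon> (\<phi> j)"
      using IH(2) insert.prems by (meson desingularizing_mono min.cobounded1 min.cobounded2 insertI1)+
    have e: "deriv (\<phi> i) t \<le> deriv (\<lambda>t. \<psi> t + \<phi> j t) t"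
      if "i \<in> insert j I" "t \<in> {0<..<?\<epsilon>}" for i t
    proof -
      have "deriv \<psi> t > 0" "deriv (\<phi> j) t > 0"
        using d that(2) unfolding desingularizing_def by blast+
      moreover have "i = j \<or> deriv (\<phi> i) t \<le> deriv \<psi> t" using IH(3) that by auto
      ultimately show ?thesis using deriv_add_desingularizing[OF d that(2)] by auto
    qed
    show ?case
    proof (intro exI conjI ballI)
      show "?\<epsilon> > 0" using IH(1) insert.prems by auto
      show "desingularizing ?\<epsilon> (\<lambda>t. \<psi> t + \<phi> j t)" by (rule desingularizing_add[OF d])
      show "?\<epsilon> \<le> \<eta> i" if "i \<in> insert j I" for i using that IH(3) by auto
    qed (rule e)
  qed
  then show ?thesis using that by blast
qed

subsection \<open>The Bregman distance as a real function\<close>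

text \<open>A real-valued version that can be differentiated; it is compared with
  \<open>bregman\<close> only on \<open>int_dom f\<close>, where \<open>f\<close> is finite.\<close>

definition bregman_real :: "('a::real_inner \<Rightarrow> ereal) \<Rightarrow> 'a \<Rightarrow> 'a \<Rightarrow> real"
  where "bregman_real f x y =
    real_of_ereal (f x) - real_of_ereal (f y) - grad f y \<bullet> (x - y)"

lemma bregman_eq_bregman_real:
  assumes "\<And>x. f x \<noteq> -\<infinity>" "x \<in> int_dom f" "y \<in> int_dom f"
  shows "bregman f x y = ereal (bregman_real f x y)"
proof -
  have "f x < \<infinity>" "f y < \<infinity>" using assms(2,3) interior_subset unfolding eff_domain_def by blast+
  then obtain s t where "f x = ereal s" "f y = ereal t"
    using assms(1)[of x] assms(1)[of y] by (cases "f x"; cases "f y") auto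
  then show ?thesis using assms(3) by (simp add: bregman_def bregman_real_def)
qed

lemma GDERIV_grad:
  fixes f :: "'a::euclidean_space \<Rightarrow> ereal"
  assumes "(\<lambda>z. real_of_ereal (f z)) differentiable at x"
  shows "GDERIV (\<lambda>z. real_of_ereal (f z)) x :> grad f x"
proof -
  obtain f' where f': "((\<lambda>z. real_of_ereal (f z)) has_derivative f') (at x)"
    using assms by (auto simp: differentiable_def)
  \<comment> \<open>\<open>adjoint f' 1\<close> is the Riesz vector of the functional
    \<open>f'\<close>.\<close>
  have eq: "(\<lambda>h. h \<bullet> adjoint f' 1) = f'"
    by (simp add: adjoint_works[OF has_derivative_linear[OF f']])
  have D: "GDERIV (\<lambda>z. real_of_ereal (f z)) x :> adjoint f' 1"
    unfolding gderiv_def eq by (rule f')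
  have uniq: "g = h" if "GDERIV (\<lambda>z. real_of_ereal (f z)) x :> g"
    "GDERIV (\<lambda>z. real_of_ereal (f z)) x :> h" for g h
    by (rule vector_eq_ldot[THEN iffD1], rule allI)
      (rule fun_cong[OF has_derivative_unique[OF that[unfolded gderiv_def]]])
  have "\<exists>!g. GDERIV (\<lambda>z. real_of_ereal (f z)) x :> g"
    using D uniq by (intro ex1I)
  then show ?thesis unfolding grad_def by (rule theI')
qed

lemma has_derivative_grad:
  assumes "C2_int_dom f" "x \<in> int_dom f"
  shows "(grad f has_derivative (\<lambda>h. hessian f x *v h)) (at x)"
  using assms jacobian_works[of "grad f" "at x"] by (simp add: C2_int_dom_def hessian_def)

lemma has_derivative_real_of_ereal:
  fixes f :: "real ^ 'd \<Rightarrow> ereal"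
  assumes "C2_int_dom f" "x \<in> int_dom f"
  shows "((\<lambda>z. real_of_ereal (f z)) has_derivative (\<lambda>h. h \<bullet> grad f x)) (at x)"
  using assms GDERIV_grad[of f x] by (simp add: C2_int_dom_def gderiv_def)

text \<open>In the direction of \<open>y\<close> the two terms with \<open>grad f y\<close> cancel,
  one from \<open>f y\<close> and one from the factor \<open>x - y\<close>, and only the Hessian
  term remains.\<close>

lemma has_derivative_bregman_real:
  fixes f :: "real ^ 'd \<Rightarrow> ereal"
  assumes "C2_int_dom f" "x \<in> int_dom f" "y \<in> int_dom f"
  shows "((\<lambda>z. bregman_real f (fst z) (snd z)) has_derivative
      (\<lambda>h. (grad f x - grad f y) \<bullet> fst h - (hessian f y *v snd h) \<bullet> (x - y))) (at (x, y))"
proof -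
  have fx: "((\<lambda>z. real_of_ereal (f z)) has_derivative (\<lambda>h. h \<bullet> grad f x)) (at (fst (x, y)))"
    and fy: "((\<lambda>z. real_of_ereal (f z)) has_derivative (\<lambda>h. h \<bullet> grad f y)) (at (snd (x, y)))"
    and gy: "(grad f has_derivative (\<lambda>h. hessian f y *v h)) (at (snd (x, y)))"
    using has_derivative_real_of_ereal[OF assms(1,2)] has_derivative_real_of_ereal[OF assms(1,3)]
      has_derivative_grad[OF assms(1,3)] by simp_all
  note D = has_derivative_compose[OF has_derivative_fst[OF has_derivative_ident] fx]
    has_derivative_compose[OF has_derivative_snd[OF has_derivative_ident] fy]
    has_derivative_compose[OF has_derivative_snd[OF has_derivative_ident] gy]
  show ?thesis unfolding bregman_real_def
    by (rule D derivative_eq_intros refl)+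
      (auto simp: fun_eq_iff inner_diff_left inner_diff_right inner_commute)
qed

text \<open>The effective domain is a projection of the epigraph. Convexity of its interior keeps
  the hull of \<open>A\<close> and \<open>B\<close> in the region where \<open>f\<close> is
  smooth.\<close>

lemma convex_int_dom:
  fixes f :: "'a::real_normed_vector \<Rightarrow> ereal"
  assumes "ereal_convex f"
  shows "convex (int_dom f)"
proof -
  have "f x < \<infinity> \<longleftrightarrow> (\<exists>t. f x \<le> ereal t)" for x
    by (cases "f x") auto
  then have "eff_domain f = fst ` {(x, t::real). f x \<le> ereal t}"
    unfolding eff_domain_def by force
  with assms have "convex (eff_domain f)"
    unfolding ereal_convex_def by (simp add: convex_linear_image linear_fst)
  then show ?thesis by (rule convex_interior)
qed

section \<open>Uniform Hessian bounds on compact sets, and strong convexity\<close>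

lemma continuous_on_matrix_vector_mult:
  fixes M :: "'a::topological_space \<Rightarrow> real ^ 'n ^ 'm" and g :: "'a \<Rightarrow> real ^ 'n"
  assumes "continuous_on S M" "continuous_on S g"
  shows "continuous_on S (\<lambda>z. M z *v g z)"
  unfolding matrix_vector_mult_def
  by (intro continuous_on_vec_lambda continuous_on_sum continuous_on_mult continuous_on_component assms)

lemma continuous_on_quadratic_form:
  fixes M :: "real ^ 'd \<Rightarrow> real ^ 'd ^ 'd"
  assumes "continuous_on S M"
  shows "continuous_on (S \<times> T) (\<lambda>z. snd z \<bullet> (M (fst z) *v snd z))"
proof -
  have "continuous_on (S \<times> T) (\<lambda>z. M (fst z))"
    by (rule continuous_on_compose2[OF assms]) (auto intro: continuous_on_fst continuous_on_id)
  then show ?thesis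
    by (intro continuous_on_inner continuous_on_matrix_vector_mult continuous_on_snd continuous_on_id)
qed

text \<open>The constant is the minimum of the quadratic form over \<open>S\<close> times the unit
  sphere; homogeneity extends the bound to all \<open>h\<close>.\<close>

lemma compact_pos_def_lower_bound:
  fixes M :: "real ^ 'd \<Rightarrow> real ^ 'd ^ 'd"
  assumes "compact S" "continuous_on S M" "\<forall>x\<in>S. pos_def (M x)"
  obtains c where "c > 0" "\<And>x h. x \<in> S \<Longrightarrow> c * (norm h)\<^sup>2 \<le> h \<bullet> (M x *v h)"
proof (cases "S = {}")
  case True
  then show ?thesis using that[of 1] by simp
next
  case False
  let ?T = "S \<times> sphere (0::real ^ 'd) 1"
  have "compact ?T" using assms(1) by (intro compact_Times) auto
  moreover have "?T \<noteq> {}" using False by auto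
  ultimately have "\<exists>p\<in>?T. \<forall>z\<in>?T. snd p \<bullet> (M (fst p) *v snd p) \<le> snd z \<bullet> (M (fst z) *v snd z)"
    by (rule continuous_attains_inf[OF _ _ continuous_on_quadratic_form[OF assms(2)]])
  then obtain p where p: "p \<in> ?T"
      "\<forall>z\<in>?T. snd p \<bullet> (M (fst p) *v snd p) \<le> snd z \<bullet> (M (fst z) *v snd z)"
    by blast
  let ?c = "snd p \<bullet> (M (fst p) *v snd p)"
  have "snd p \<noteq> 0" using p(1) by auto
  then have "?c > 0" using p(1) assms(3) unfolding pos_def_def by auto
  moreover have "?c * (norm h)\<^sup>2 \<le> h \<bullet> (M x *v h)" if "x \<in> S" for x h
  proof (cases "h = 0")
    case False
    then have T: "(x, (1 / norm h) *\<^sub>R h) \<in> ?T" using that by auto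
    have "?c \<le> ((1 / norm h) *\<^sub>R h) \<bullet> (M x *v ((1 / norm h) *\<^sub>R h))"
      using bspec[OF p(2) T] by (simp only: fst_conv snd_conv)
    also have "\<dots> = (h \<bullet> (M x *v h)) / (norm h)\<^sup>2"
      by (simp add: matrix_vector_mult_scaleR power2_eq_square)
    finally show ?thesis using False by (simp add: field_simps)
  qed simp
  ultimately show ?thesis by (rule that)
qed

lemma compact_vector_matrix_bound:
  fixes M :: "'a::topological_space \<Rightarrow> real ^ 'd ^ 'd"
  assumes "compact S" "continuous_on S M"
  obtains C where "C > 0" "\<And>x w. x \<in> S \<Longrightarrow> norm (w v* M x) \<le> C * norm w"
proof -
  have "bounded (M ` S)" using assms by (intro compact_imp_bounded compact_continuous_image)
  then obtain C where C: "C > 0" "\<And>x. x \<in> S \<Longrightarrow> norm (M x) \<le> C"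
    by (auto simp: bounded_pos)
  have "norm (w v* M x) \<le> (C * CARD('d)) * norm w" if "x \<in> S" for x w
  proof -
    \<comment> \<open>The product is a combination of the rows of \<open>M x\<close>, each of norm
      at most \<open>C\<close>; this explains the factor \<open>CARD('d)\<close>.\<close>
    have "norm (w v* M x) = norm (\<Sum>i\<in>UNIV. (w $ i) *\<^sub>R (M x $ i))"
      by (rule arg_cong[of _ _ norm]) (simp add: vec_eq_iff vector_matrix_mult_def mult.commute)
    also have "\<dots> \<le> (\<Sum>i\<in>(UNIV::'d set). C * norm w)"
    proof (rule sum_norm_le)
      fix i
      have "norm (M x $ i) \<le> C" using Finite_Cartesian_Product.norm_nth_le[of "M x" i] C(2)[OF that] by linarith
      then have "\<bar>w $ i\<bar> * norm (M x $ i) \<le> norm w * C"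
        using component_le_norm_cart[of w i] by (intro mult_mono) auto
      then show "norm ((w $ i) *\<^sub>R (M x $ i)) \<le> C * norm w"
        by (simp only: norm_scaleR mult.commute[of C])
    qed
    finally show ?thesis by (simp add: mult_ac)
  qed
  then show ?thesis using that[of "C * CARD('d)"] C(1) by auto
qed

text \<open>The Bregman distance is the second-order Taylor remainder of \<open>f\<close> along the
  segment from \<open>y\<close> to \<open>x\<close>, that is, half a second derivative at an
  intermediate point.\<close>

lemma bregman_real_lower_bound:
  fixes f :: "real ^ 'd \<Rightarrow> ereal"
  assumes C2: "C2_int_dom f" and seg: "closed_segment y x \<subseteq> int_dom f"
    and lower: "\<And>z h. z \<in> closed_segment y x \<Longrightarrow> c * (norm h)\<^sup>2 \<le> h \<bullet> (hessian f z *v h)"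
  shows "c / 2 * (norm (x - y))\<^sup>2 \<le> bregman_real f x y"
proof -
  let ?h = "x - y"
  let ?l = "\<lambda>t. y + t *\<^sub>R ?h"
  \<comment> \<open>For \<open>m\<close> up to 2, \<open>p m\<close> is the derivative of order
    \<open>m\<close> of \<open>f\<close> along the segment, in the indexed form that
    \<open>Maclaurin\<close> expects.\<close>
  define p where "p m t = (if m = 0 then real_of_ereal (f (?l t))
    else if m = 1 then grad f (?l t) \<bullet> ?h else (hessian f (?l t) *v ?h) \<bullet> ?h)" for m :: nat and t
  have l: "?l t \<in> closed_segment y x" if "0 \<le> t" "t \<le> 1" for t
    using that unfolding closed_segment_def by (auto simp: algebra_simps intro!: exI[of _ t])
  have dl: "(?l has_derivative (\<lambda>s. s *\<^sub>R ?h)) (at t)" for t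
    by (auto intro!: derivative_eq_intros)
  have d: "(p m has_real_derivative p (Suc m) t) (at t)" if "m < 2" "0 \<le> t" "t \<le> 1" for m t
  proof -
    have i: "?l t \<in> int_dom f" using l seg that by blast
    have 0: "((\<lambda>t. real_of_ereal (f (?l t))) has_derivative (\<lambda>s. (s *\<^sub>R ?h) \<bullet> grad f (?l t))) (at t)"
      by (rule has_derivative_compose[OF dl has_derivative_real_of_ereal[OF C2 i]])
    have 1: "((\<lambda>t. grad f (?l t)) has_derivative (\<lambda>s. hessian f (?l t) *v (s *\<^sub>R ?h))) (at t)"
      by (rule has_derivative_compose[OF dl has_derivative_grad[OF C2 i]])
    have 1: "((\<lambda>t. grad f (?l t) \<bullet> ?h) has_derivative
        (\<lambda>s. (hessian f (?l t) *v (s *\<^sub>R ?h)) \<bullet> ?h)) (at t)"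
      by (rule has_derivative_inner_left[OF 1])
    from \<open>m < 2\<close> consider "m = 0" | "m = 1" by linarith
    then show ?thesis
    proof cases
      case 1
      then show ?thesis
        using 0 by (simp add: p_def[abs_def] has_field_derivative_def inner_commute mult_commute_abs)
    next
      case 2
      then show ?thesis
        using 1 by (simp add: p_def[abs_def] has_field_derivative_def matrix_vector_mult_scaleR mult_commute_abs)
    qed
  qed
  have "\<exists>t>0. t < 1 \<and> p 0 1 = (\<Sum>m<2. p m 0 / fact m * 1 ^ m) + p 2 t / fact 2 * 1 ^ 2"
    by (rule Maclaurin) (use d in auto)
  then obtain t where t: "0 < t" "t < 1" "p 0 1 = p 0 0 + p 1 0 + p 2 t / 2"
    by (auto simp: numeral_2_eq_2)
  have "c * (norm ?h)\<^sup>2 \<le> p 2 t"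
    using lower[OF l[of t], of ?h] t by (simp add: p_def inner_commute)
  with t(3) show ?thesis by (simp add: p_def bregman_real_def)
qed

subsection \<open>The angle condition\<close>

text \<open>Stated as an inequality because of the junk values at \<open>u = 0\<close>, \<open>v \<noteq> 0\<close>: there the scaling
  factor is \<open>0\<close> and the angle \<open>\<pi> / 2\<close>, so the two sides are \<open>|v|\<^sup>2\<close> and \<open>2 |v|\<^sup>2\<close>.\<close>

lemma norm_scaled_diff_le_angle:
  fixes u v :: "'a::real_inner"
  shows "(norm ((norm v / norm u) *\<^sub>R u - v))\<^sup>2 \<le> 2 * (norm v)\<^sup>2 * (1 - cos (vec_angle u v))"
proof -
  have "\<bar>u \<bullet> v / (norm u * norm v)\<bar> \<le> 1"
    using Cauchy_Schwarz_ineq2[of u v] by (cases "u = 0 \<or> v = 0") (auto simp: divide_le_eq_1)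
  then have cos: "cos (vec_angle u v) = u \<bullet> v / (norm u * norm v)"
    unfolding vec_angle_def by (intro cos_arccos) (simp_all only: abs_le_iff minus_le_iff)
  show ?thesis
  proof (cases "u = 0 \<or> v = 0")
    case True
    then show ?thesis by (auto simp: cos)
  next
    case False
    have "(norm ((norm v / norm u) *\<^sub>R u - v))\<^sup>2 =
        (norm v / norm u)\<^sup>2 * (norm u)\<^sup>2 - 2 * (norm v / norm u) * (u \<bullet> v) + (norm v)\<^sup>2"
      unfolding power2_norm_eq_inner
      by (simp add: inner_diff_left inner_diff_right inner_commute power2_eq_square algebra_simps)
    also have "\<dots> = 2 * (norm v)\<^sup>2 * (1 - cos (vec_angle u v))"
      using False by (simp add: cos field_simps power2_eq_square)
    finally show ?thesis by simp
  qed
qed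

text \<open>The two minimality properties are fed directly into a smooth minorant of
  \<open>F\<close> that touches it at \<open>(b', a)\<close>. The product \<open>v*\<close> arises
  by moving the Hessian from the increment of \<open>y\<close> to the other factor of the inner
  product.\<close>

lemma building_block_subgradient:
  fixes f :: "real ^ 'd \<Rightarrow> ereal"
  assumes ninf: "\<And>x. f x \<noteq> -\<infinity>" and C2: "C2_int_dom f"
    and A: "A \<subseteq> int_dom f" and B: "B \<subseteq> int_dom f"
    and block: "rl_building_block f A B b a b'" and s: "s \<ge> 0"
  shows "(0, (s *\<^sub>R (b - a) - (b' - a)) v* hessian f a)
    \<in> frechet_subdiff (\<lambda>(x, y). ind_fun B x + bregman f x y + ind_fun A y) (b', a)"
proof -
  note D = bregman_eq_bregman_real[of f, OF ninf]
  have mem: "b \<in> B" "a \<in> A" "b' \<in> B"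
    and mina: "\<And>y. y \<in> A \<Longrightarrow> \<not> bregman f b y < bregman f b a"
    and minb: "\<And>x. x \<in> B \<Longrightarrow> \<not> bregman f x a < bregman f b' a"
    using block unfolding rl_building_block_def left_proj_def right_proj_def is_arg_min_def by auto
  then have int: "b \<in> int_dom f" "a \<in> int_dom f" "b' \<in> int_dom f" using A B by auto
  have mina: "bregman_real f b a \<le> bregman_real f b y" if "y \<in> A" for y
    using mina[OF that] D that A int by (metis less_ereal.simps(1) not_less subsetD)
  have minb: "bregman_real f b' a \<le> bregman_real f x a" if "x \<in> B" for x
    using minb[OF that] D that B int by (metis less_ereal.simps(1) not_less subsetD)
  define v where "v = (s *\<^sub>R (b - a) - (b' - a)) v* hessian f a"
  \<comment> \<open>Up to constants, \<open>D(x, y)\<close> minus the linear function \<open>v \<bullet> y\<close> and minus terms minimal at \<open>x = b'\<close>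
    on \<open>B\<close> and at \<open>y = a\<close> on \<open>A\<close>. Its derivative at \<open>(b', a)\<close> vanishes.\<close>
  define \<theta> where "\<theta> z = bregman_real f (fst z) (snd z) - bregman_real f (fst z) a
    - s * bregman_real f b (snd z) - v \<bullet> snd z" for z
  have 1: "((\<lambda>z. bregman_real f (fst z) a) has_derivative
      (\<lambda>h. (grad f b' - grad f a) \<bullet> fst h)) (at (b', a))"
  proof -
    have "((\<lambda>z. (fst z, a)) has_derivative (\<lambda>h. (fst h, 0))) (at (b', a))"
      by (auto intro!: derivative_eq_intros)
    from has_derivative_compose[OF this, of "\<lambda>z. bregman_real f (fst z) (snd z)"]
    show ?thesis using has_derivative_bregman_real[OF C2 int(3,2)] by fastforce
  qed
  have 2: "((\<lambda>z. bregman_real f b (snd z)) has_derivative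
      (\<lambda>h. - ((hessian f a *v snd h) \<bullet> (b - a)))) (at (b', a))"
  proof -
    have "((\<lambda>z. (b, snd z)) has_derivative (\<lambda>h. (0, snd h))) (at (b', a))"
      by (auto intro!: derivative_eq_intros)
    from has_derivative_compose[OF this, of "\<lambda>z. bregman_real f (fst z) (snd z)"]
    show ?thesis using has_derivative_bregman_real[OF C2 int(1,2)] by fastforce
  qed
  have vk: "v \<bullet> k = s * ((hessian f a *v k) \<bullet> (b - a)) - (hessian f a *v k) \<bullet> (b' - a)" for k
    unfolding v_def dot_lmul_matrix
    by (simp add: inner_diff_left inner_diff_right inner_scaleR_right inner_commute)
  \<comment> \<open>The gradient differences cancel in the first component; \<open>v\<close> was
    chosen so that the second vanishes, by \<open>vk\<close>.\<close>
  have "(\<theta> has_derivative (\<lambda>h. 0)) (at (b', a))"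
    unfolding \<theta>_def[abs_def]
    by (rule derivative_eq_intros 1 2 has_derivative_bregman_real[OF C2 int(3,2)] refl)+
      (simp add: vk)
  moreover have "\<forall>\<^sub>F z in at (b', a). ereal (bregman_real f b' a + (0, v) \<bullet> (z - (b', a))
      + (\<theta> z - \<theta> (b', a))) \<le> (\<lambda>(x, y). ind_fun B x + bregman f x y + ind_fun A y) z"
  proof (intro always_eventually allI)
    fix z :: "(real ^ 'd) \<times> (real ^ 'd)"
    obtain x y where z: "z = (x, y)" by force
    show "ereal (bregman_real f b' a + (0, v) \<bullet> (z - (b', a)) + (\<theta> z - \<theta> (b', a)))
      \<le> (\<lambda>(x, y). ind_fun B x + bregman f x y + ind_fun A y) z"
    proof (cases "x \<in> B \<and> y \<in> A")
      case True
      have "s * bregman_real f b a \<le> s * bregman_real f b y"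
        using mina True s by (intro mult_left_mono) auto
      \<comment> \<open>The terms with \<open>v\<close> cancel. What remains on the left is
        \<open>bregman_real f x y\<close> less two nonnegative excesses: that of D(., a) at
        \<open>x\<close> over \<open>b'\<close>, and \<open>s\<close> times that of D(b, .) at
        \<open>y\<close> over \<open>a\<close>.\<close>
      then have "bregman_real f b' a + (0, v) \<bullet> (z - (b', a)) + (\<theta> z - \<theta> (b', a)) \<le> bregman_real f x y"
        using minb[of x] True by (simp add: \<theta>_def z inner_diff_right)
      moreover have "bregman f x y = ereal (bregman_real f x y)"
        using D True A B by blast
      ultimately show ?thesis using True by (simp add: z ind_fun_def)
    qed (auto simp: z ind_fun_def)
  qed
  moreover have "(\<lambda>(x, y). ind_fun B x + bregman f x y + ind_fun A y) (b', a) = ereal (bregman_real f b' a)"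
    using D int mem by (simp add: ind_fun_def)
  ultimately show ?thesis unfolding v_def[symmetric] by (rule mem_frechet_subdiffI[rotated])
qed

section \<open>From local Kurdyka-Lojasiewicz inequalities to a uniform angle condition\<close>

theorem proposition5p3:
  fixes f :: "real ^ 'd \<Rightarrow> ereal" and A B :: "(real ^ 'd) set"
    and K :: "((real ^ 'd) \<times> (real ^ 'd)) set" and r :: real
  assumes "legendre_type f" and "C2_int_dom f" and "\<forall>x\<in>int_dom f. pos_def (hessian f x)"
    and "A \<noteq> {}" and "closed A" and "bounded A" and "A \<subseteq> int_dom f"
    and "B \<noteq> {}" and "closed B" and "bounded B" and "B \<subseteq> int_dom f"
    and "is_gap f A B K r"
    and "\<forall>(b, a)\<in>K. KL_at (\<lambda>(x, y). ind_fun B x + bregman f x y + ind_fun A y) (b, a)"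
  shows "\<exists>W \<phi> \<gamma> \<eta>. open W \<and> K \<subseteq> W \<and> \<gamma> > 0 \<and> \<eta> > 0 \<and> desingularizing \<eta> \<phi> \<and>
    (\<forall>b a' b'. rl_building_block f A B b a' b' \<longrightarrow> (b', a') \<in> W \<longrightarrow>
       ereal (r\<^sup>2 / 2) < bregman f b' a' \<longrightarrow> bregman f b' a' < ereal (r\<^sup>2 / 2 + \<eta>) \<longrightarrow>
       (deriv \<phi> (real_of_ereal (left_dist f B a') - r\<^sup>2 / 2))\<^sup>2 * real_of_ereal (left_dist f B a')
         * (1 - cos (vec_angle (b - a') (b' - a'))) \<ge> \<gamma>)"
proof -
  let ?F = "\<lambda>(x, y). ind_fun B x + bregman f x y + ind_fun A y"
  have ninf: "\<And>x. f x \<noteq> -\<infinity>" and conv: "convex (int_dom f)"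
    using assms(1) convex_int_dom unfolding legendre_type_def by auto
  note D = bregman_eq_bregman_real[of f, OF ninf]
  have K: "compact K" "K \<subseteq> B \<times> A" and FK: "\<And>p. p \<in> K \<Longrightarrow> ?F p = ereal (r\<^sup>2 / 2)"
    using assms(12) unfolding is_gap_def by (fastforce simp: ind_fun_def)+
  have cont: "continuous_on (int_dom f) (hessian f)" using assms(2) by (simp add: C2_int_dom_def)
  \<comment> \<open>The hull contains every segment between a point of \<open>A\<close> and a point
    of \<open>B\<close>, as the Taylor bound requires, and its compactness makes \<open>c\<close>
    and \<open>C\<close> uniform.\<close>
  define S where "S = convex hull (A \<union> B)"
  have S: "compact S" "convex S" "S \<subseteq> int_dom f" "A \<subseteq> S" "B \<subseteq> S"
  proof -
    show "compact S" unfolding S_def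
      by (intro compact_convex_hull compact_Un) (use assms(5,6,9,10) in \<open>auto simp: compact_eq_bounded_closed\<close>)
    show "S \<subseteq> int_dom f" unfolding S_def
      by (intro hull_minimal) (use assms(7,11) conv in auto)
  qed (auto simp: S_def hull_inc)
  obtain c where c: "c > 0" "\<And>x h. x \<in> S \<Longrightarrow> c * (norm h)\<^sup>2 \<le> h \<bullet> (hessian f x *v h)"
    using compact_pos_def_lower_bound[OF S(1) continuous_on_subset[OF cont S(3)]] assms(3) S(3) by blast
  obtain C where C: "C > 0" "\<And>x w. x \<in> S \<Longrightarrow> norm (w v* hessian f x) \<le> C * norm w"
    using compact_vector_matrix_bound[OF S(1) continuous_on_subset[OF cont S(3)]] by blast
  \<comment> \<open>\<open>F\<close> equals \<open>r\<^sup>2 / 2\<close> throughout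
    \<open>K\<close>, so the local inequalities share one reference level and their desingularizing
    functions can be added.\<close>
  define KL where "KL p \<eta> U \<phi> \<longleftrightarrow> (\<eta> > 0 \<and> open U \<and> p \<in> U \<and> desingularizing \<eta> \<phi>) \<and>
      (\<forall>z v d. z \<in> U \<longrightarrow> ?F z = ereal d \<longrightarrow> r\<^sup>2 / 2 < d \<longrightarrow> d < r\<^sup>2 / 2 + \<eta> \<longrightarrow> v \<in> limiting_subdiff ?F z
        \<longrightarrow> deriv \<phi> (d - r\<^sup>2 / 2) * norm v \<ge> 1)" for p \<eta> U \<phi>
  have "\<exists>\<eta> U \<phi>. KL p \<eta> U \<phi>" if p: "p \<in> K" for p
  proof -
    from p have "KL_at ?F p" using assms(13) by auto
    then obtain \<eta> U \<phi> where 1: "\<eta> > 0" "open U" "p \<in> U" "desingularizing \<eta> \<phi>"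
      and 2: "\<And>x v c d. \<lbrakk>x \<in> U; ?F p = ereal c; ?F x = ereal d; c < d; d < c + \<eta>; v \<in> limiting_subdiff ?F x\<rbrakk>
         \<Longrightarrow> deriv \<phi> (d - c) * norm v \<ge> 1"
      by (rule KL_atE) (rule that)
    have "KL p \<eta> U \<phi>" unfolding KL_def
      by (intro conjI allI impI 1 2[OF _ FK[OF p]])
    then show ?thesis by blast
  qed
  then obtain \<eta> U \<phi> where KL: "\<And>p. p \<in> K \<Longrightarrow> KL p (\<eta> p) (U p) (\<phi> p)"
    by metis
  have loc: "\<eta> p > 0 \<and> open (U p) \<and> p \<in> U p \<and> desingularizing (\<eta> p) (\<phi> p)" if "p \<in> K" for p
    using KL[OF that] unfolding KL_def by (rule conjunct1)
  obtain I where I: "I \<subseteq> K" "finite I" "K \<subseteq> (\<Union>p\<in>I. U p)"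
    using compactE_image[OF K(1), of K U] loc by blast
  obtain \<delta> \<psi> where \<psi>: "\<delta> > 0" "desingularizing \<delta> \<psi>" "\<And>p. p \<in> I \<Longrightarrow> \<delta> \<le> \<eta> p"
    "\<And>p t. p \<in> I \<Longrightarrow> t \<in> {0<..<\<delta>} \<Longrightarrow> deriv (\<phi> p) t \<le> deriv \<psi> t"
    using finite_desingularizing_bound[OF I(2), of \<eta> \<phi>] loc I(1) by blast
  \<comment> \<open>The constant comes from squaring the Kurdyka-Lojasiewicz bound, which gives
    \<open>C\<^sup>2\<close>, and from |w|^2 <= (4/c) d e below.\<close>
  have main: "(deriv \<psi> (real_of_ereal (left_dist f B a) - r\<^sup>2 / 2))\<^sup>2 * real_of_ereal (left_dist f B a)
         * (1 - cos (vec_angle (b - a) (b' - a))) \<ge> c / (4 * C\<^sup>2)"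
    if block: "rl_building_block f A B b a b'" and W: "(b', a) \<in> (\<Union>p\<in>I. U p)"
      and lo: "ereal (r\<^sup>2 / 2) < bregman f b' a" and hi: "bregman f b' a < ereal (r\<^sup>2 / 2 + \<delta>)"
    for b a b'
  proof -
    have mem: "a \<in> A" "b' \<in> B" and min: "\<And>x. x \<in> B \<Longrightarrow> \<not> bregman f x a < bregman f b' a"
      using block unfolding rl_building_block_def left_proj_def right_proj_def is_arg_min_def by auto
    then have int: "a \<in> int_dom f" "b' \<in> int_dom f" using assms(7,11) by auto
    define d where "d = bregman_real f b' a"
    have d: "bregman f b' a = ereal d" using D int by (simp add: d_def)
    have "left_dist f B a = bregman f b' a" unfolding left_dist_def
      using min mem by (intro antisym INF_lower INF_greatest) (auto simp: not_less)
    then have ld: "real_of_ereal (left_dist f B a) = d" by (simp add: d)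
    let ?u = "b - a" and ?v = "b' - a"
    define e where "e = 1 - cos (vec_angle ?u ?v)"
    \<comment> \<open>If \<open>b = a\<close>, the quotient is 0, still an admissible scaling for
      the subgradient.\<close>
    define w where "w = (norm ?v / norm ?u) *\<^sub>R ?u - ?v"
    have sub: "(0, w v* hessian f a) \<in> limiting_subdiff ?F (b', a)"
      using building_block_subgradient[OF ninf assms(2,7,11) block, of "norm ?v / norm ?u"]
        frechet_subdiff_subset_limiting_subdiff unfolding w_def by auto
    obtain p where p: "p \<in> I" "(b', a) \<in> U p" using W by auto
    have Fd: "?F (b', a) = ereal d" using mem d by (simp add: ind_fun_def)
    have t: "r\<^sup>2 / 2 < d" "d < r\<^sup>2 / 2 + \<delta>" using lo hi d by auto
    have "KL p (\<eta> p) (U p) (\<phi> p)" using KL I(1) p(1) by blast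
    then have "1 \<le> deriv (\<phi> p) (d - r\<^sup>2 / 2) * norm (0::real ^ 'd, w v* hessian f a)"
      unfolding KL_def using p(2) Fd t sub \<psi>(3)[OF p(1)] by (meson add_left_mono less_le_trans)
    also have "\<dots> \<le> deriv \<psi> (d - r\<^sup>2 / 2) * (C * norm w)"
    proof (rule mult_mono)
      show "deriv (\<phi> p) (d - r\<^sup>2 / 2) \<le> deriv \<psi> (d - r\<^sup>2 / 2)" using \<psi>(4) p(1) t by auto
      show "norm (0::real ^ 'd, w v* hessian f a) \<le> C * norm w"
        using C(2) S(4) mem by (auto simp: norm_Pair)
      show "0 \<le> deriv \<psi> (d - r\<^sup>2 / 2)"
        using \<psi>(2) t unfolding desingularizing_def by (auto intro: less_imp_le)
    qed simp
    finally have "1 \<le> (deriv \<psi> (d - r\<^sup>2 / 2) * (C * norm w))\<^sup>2" by (rule one_le_power)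
    also have "\<dots> = (deriv \<psi> (d - r\<^sup>2 / 2))\<^sup>2 * C\<^sup>2 * (norm w)\<^sup>2" by (simp add: power_mult_distrib)
    \<comment> \<open>The factor \<open>4 / c\<close> is the product of \<open>2 / c\<close> from
      strong convexity and 2 from the angle estimate.\<close>
    also have "\<dots> \<le> (deriv \<psi> (d - r\<^sup>2 / 2))\<^sup>2 * C\<^sup>2 * (4 / c * d * e)"
    proof (intro mult_left_mono)
      have "c / 2 * (norm ?v)\<^sup>2 \<le> d" unfolding d_def
      proof (rule bregman_real_lower_bound[OF assms(2)])
        have seg: "closed_segment a b' \<subseteq> S" using S mem by (intro closed_segment_subset) auto
        then show "closed_segment a b' \<subseteq> int_dom f" using S(3) by blast
        show "c * (norm h)\<^sup>2 \<le> h \<bullet> (hessian f z *v h)" if "z \<in> closed_segment a b'" for z h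
          using that seg c(2) by blast
      qed
      then have "(norm ?v)\<^sup>2 \<le> 2 / c * d" using c(1) by (simp add: field_simps)
      then have "2 * (norm ?v)\<^sup>2 * e \<le> 2 * (2 / c * d) * e"
        by (intro mult_right_mono mult_left_mono) (auto simp: e_def)
      then show "(norm w)\<^sup>2 \<le> 4 / c * d * e"
        using norm_scaled_diff_le_angle[of ?v ?u] unfolding w_def e_def by simp
    qed simp
    finally show ?thesis
      using c(1) C(1) unfolding ld e_def[symmetric] by (simp add: field_simps)
  qed
  have "open (\<Union>p\<in>I. U p)" using loc I(1) by blast
  moreover have "c / (4 * C\<^sup>2) > 0" using c(1) C(1) by simp
  ultimately show ?thesis using I(3) \<psi>(1,2) main
    by (intro exI[of _ "\<Union>p\<in>I. U p"] exI[of _ \<psi>] exI[of _ "c / (4 * C\<^sup>2)"] exI[of _ \<delta>]) blast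
qed

end
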